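(* Let $\mathcal{H}_A$ be a finite-dimensional complex Hilbert space and let $\mathcal{H}_{A'}$, $\mathcal{H}_{A''}$ be copies of $\mathcal{H}_A$. There exists a universal broadcasting map $\mathcal{E}_{A'A''|A}:\mathfrak{L}(\mathcal{H}_A)\to\mathfrak{L}(\mathcal{H}_{A'}\otimes\mathcal{H}_{A''})$ if and only if there exists a density operator $\tau_{AA'A''}$ on $\mathcal{H}_A\otimes\mathcal{H}_{A'}\otimes\mathcal{H}_{A''}$ whose bipartite reduced states $\tau_{AA'}=\mathrm{Tr}_{A''}(\tau_{AA'A''})$ and $\tau_{AA''}=\mathrm{Tr}_{A'}(\tau_{AA'A''})$ are both pure and maximally entangled.
   Context: $\mathfrak{L}(\mathcal{H})$ is the space of linear operators on $\mathcal{H}$. A trace-preserving completely positive (TPCP) map $\mathcal{E}_{A'A''|A}:\mathfrak{L}(\mathcal{H}_A)\to\mathfrak{L}(\mathcal{H}_{A'}\otimes\mathcal{H}_{A''})$ has reduced maps $\mathcal{E}_{A'|A}=\mathrm{Tr}_{A''}\circ\mathcal{E}_{A'A''|A}$ and $\mathcal{E}_{A''|A}=\mathrm{Tr}_{A'}\circ\mathcal{E}_{A'A''|A}$. It is broadcasting for a density operator $\rho$ on $\mathcal{H}_A$ if $\mathcal{E}_{A'|A}(\rho)=\rho$ and $\mathcal{E}_{A''|A}(\rho)=\rho$ (identifying the three copies of the Hilbert space). It is a universal broadcasting map if it is broadcasting for every density operator on $\mathcal{H}_A$; equivalently, both reduced maps are the identity map. A pure state $|\psi\rangle\langle\psi|$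 on the tensor product of two $d$-dimensional Hilbert spaces is maximally entangled if $|\psi\rangle=\frac{1}{\sqrt d}\sum_{j=1}^d|e_j\rangle\otimes|f_j\rangle$ for some orthonormal bases $\{|e_j\rangle\},\{|f_j\rangle\}$ of the two spaces. *)

theory Defs
  imports "HOL-Analysis.Analysis"
begin

text \<open>
  A Hilbert space of dimension \<open>d \<ge> 1\<close> is \<open>complex ^ 'a\<close> with \<open>d = CARD('a)\<close> and the sesquilinear
  inner product below (the library inner product on this type is its real part).  Operators
  are square matrices, and the tensor product of the spaces with index types \<open>'a\<close> and \<open>'b\<close> is
  the space with index type \<open>'a \<times> 'b\<close>, the basis vector \<open>(i, j)\<close> standing for the tensor product of
  the basis vectors \<open>i\<close> and \<open>j\<close>.
\<close>

type_synonym 'a operator = "complex ^ 'a ^ 'a"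

definition cinner :: "complex ^ 'a::finite \<Rightarrow> complex ^ 'a \<Rightarrow> complex" where
  "cinner v w = (\<Sum>i\<in>UNIV. cnj (v $ i) * w $ i)"

definition tensor_vec :: "complex ^ 'a::finite \<Rightarrow> complex ^ 'b::finite \<Rightarrow> complex ^ ('a \<times> 'b)" where
  "tensor_vec v w = (\<chi> p. v $ fst p * w $ snd p)"

definition rank_one :: "complex ^ 'a::finite \<Rightarrow> 'a operator" where
  "rank_one \<psi> = (\<chi> i j. \<psi> $ i * cnj (\<psi> $ j))"

definition op_scale :: "complex \<Rightarrow> 'a::finite operator \<Rightarrow> 'a operator" where
  "op_scale c X = (\<chi> i j. c * X $ i $ j)"

definition positive_op :: "'a::finite operator \<Rightarrow> bool" where
  "positive_op X \<longleftrightarrow> (\<forall>v. cinner v (X *v v) \<in> \<real>\<^sub>\<ge>\<^sub>0)"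

definition density_operator :: "'a::finite operator \<Rightarrow> bool" where
  "density_operator \<rho> \<longleftrightarrow> positive_op \<rho> \<and> trace \<rho> = 1"

definition trace_fst :: "('a::finite \<times> 'b::finite) operator \<Rightarrow> 'b operator" where
  "trace_fst X = (\<chi> i j. \<Sum>a\<in>UNIV. X $ (a, i) $ (a, j))"

definition trace_snd :: "('a::finite \<times> 'b::finite) operator \<Rightarrow> 'a operator" where
  "trace_snd X = (\<chi> i j. \<Sum>b\<in>UNIV. X $ (i, b) $ (j, b))"

definition trace_second :: "('a::finite \<times> 'b::finite \<times> 'c::finite) operator \<Rightarrow> ('a \<times> 'c) operator" where
  "trace_second X = (\<chi> p q. \<Sum>b\<in>UNIV. X $ (fst p, b, snd p) $ (fst q, b, snd q))"

definition trace_third :: "('a::finite \<times> 'b::finite \<times> 'c::finite) operator \<Rightarrow> ('a \<times> 'b) operator" where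
  "trace_third X = (\<chi> p q. \<Sum>c\<in>UNIV. X $ (fst p, snd p, c) $ (fst q, snd q, c))"

text \<open>
  Complete positivity quantifies over ancilla spaces of every dimension \<open>k\<close>, so these cannot be
  index types.  An operator on the tensor product of the space with a \<open>k\<close>-dimensional ancilla is
  instead given by its \<open>k \<times> k\<close> blocks \<open>X i j\<close> (\<open>i, j < k\<close>), i.e. it is the sum of the \<open>X i j\<close>
  tensored with the matrix units \<open>(i, j)\<close> of the ancilla, and a vector by its \<open>k\<close> blocks.  Tensoring
  a map with the identity on the ancilla operators is then the blockwise application of that map.
\<close>

definition positive_block :: "nat \<Rightarrow> (nat \<Rightarrow> nat \<Rightarrow> 'a::finite operator) \<Rightarrow> bool" where
  "positive_block k X \<longleftrightarrow>
     (\<forall>v :: nat \<Rightarrow> complex ^ 'a. (\<Sum>i<k. \<Sum>j<k. cinner (v i) (X i j *v v j)) \<in> \<real>\<^sub>\<ge>\<^sub>0)"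

definition completely_positive :: "('a::finite operator \<Rightarrow> 'b::finite operator) \<Rightarrow> bool" where
  "completely_positive E \<longleftrightarrow>
     (\<forall>k X. positive_block k X \<longrightarrow> positive_block k (\<lambda>i j. E (X i j)))"

definition tpcp :: "('a::finite operator \<Rightarrow> 'b::finite operator) \<Rightarrow> bool" where
  "tpcp E \<longleftrightarrow> Vector_Spaces.linear op_scale op_scale E \<and>
     completely_positive E \<and> (\<forall>X. trace (E X) = trace X)"

definition broadcasting :: "('a::finite operator \<Rightarrow> ('a \<times> 'a) operator) \<Rightarrow> 'a operator \<Rightarrow> bool" where
  "broadcasting E \<rho> \<longleftrightarrow> (trace_snd \<circ> E) \<rho> = \<rho> \<and> (trace_fst \<circ> E) \<rho> = \<rho>"

definition universal_broadcasting :: "('a::finite operator \<Rightarrow> ('a \<times> 'a) operator) \<Rightarrow> bool" where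
  "universal_broadcasting E \<longleftrightarrow> tpcp E \<and> (\<forall>\<rho>. density_operator \<rho> \<longrightarrow> broadcasting E \<rho>)"

definition pure_state :: "'a::finite operator \<Rightarrow> bool" where
  "pure_state \<rho> \<longleftrightarrow> (\<exists>\<psi>. cinner \<psi> \<psi> = 1 \<and> \<rho> = rank_one \<psi>)"

definition orthonormal_basis :: "('a \<Rightarrow> complex ^ 'a::finite) \<Rightarrow> bool" where
  "orthonormal_basis e \<longleftrightarrow>
     (\<forall>i j. cinner (e i) (e j) = (if i = j then 1 else 0)) \<and> vec.span (range e) = UNIV"

definition maximally_entangled :: "('a::finite \<times> 'a) operator \<Rightarrow> bool" where
  "maximally_entangled \<rho> \<longleftrightarrow>
     (\<exists>e f. orthonormal_basis e \<and> orthonormal_basis f \<and>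
        \<rho> = rank_one (complex_of_real (1 / sqrt (real CARD('a))) *s
              (\<Sum>j\<in>UNIV. tensor_vec (e j) (f j))))"

end

theory Submission imports Defs begin

text \<open>
  From a universal broadcasting map one obtains \<open>\<tau>\<close> by applying it to one half of the maximally
  entangled state of the standard basis (the Choi operator): since pure states span all operators,
  both reduced maps are the identity, so both reduced states are that entangled state again.

  Conversely, entanglement is monogamous. If \<open>\<tau>\<close> has a pure reduced state on \<open>A A'\<close>, then \<open>\<tau>\<close> is
  the product of that state with an operator \<open>\<sigma>\<close> on \<open>A''\<close>. If the pure state is maximally
  entangled, then the reduced state on \<open>A A''\<close> is \<open>(1/d) I\<close> tensored with \<open>\<sigma>\<close>, which has rank
  one only when \<open>d = 1\<close>; and in dimension one broadcasting is trivial.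
\<close>

section \<open>Matrix units, rank-one operators and their quadratic forms\<close>

definition matrix_unit :: "'a \<Rightarrow> 'a \<Rightarrow> 'a::finite operator" where
  "matrix_unit a b = (\<chi> i j. if i = a \<and> j = b then 1 else 0)"

lemma vector_space_op_scale: "vector_space (op_scale :: complex \<Rightarrow> 'a::finite operator \<Rightarrow> _)"
  by unfold_locales (auto simp: op_scale_def vec_eq_iff algebra_simps)

lemma sum_UNIV_prod:
  "(\<Sum>x\<in>(UNIV :: ('a::finite \<times> 'b::finite) set). f x) = (\<Sum>a\<in>UNIV. \<Sum>b\<in>UNIV. f (a, b))"
  by (simp add: sum.cartesian_product)

lemma cinner_matrix_vector_mult:
  "cinner v (X *v w) = (\<Sum>p\<in>UNIV. \<Sum>q\<in>UNIV. cnj (v $ p) * X $ p $ q * w $ q)"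
  by (simp add: cinner_def matrix_vector_mult_def sum_distrib_left mult.assoc)

lemma cinner_self: "cinner v v = complex_of_real (\<Sum>i\<in>UNIV. (cmod (v $ i))\<^sup>2)"
  unfolding cinner_def of_real_sum complex_norm_square by (simp add: mult.commute)

lemma cinner_rank_one:
  "cinner v (rank_one \<psi> *v v) = complex_of_real ((cmod (cinner v \<psi>))\<^sup>2)"
proof -
  have "cinner v (rank_one \<psi> *v v) = cinner v \<psi> * cnj (cinner v \<psi>)"
    unfolding cinner_matrix_vector_mult unfolding cinner_def rank_one_def
    by (simp add: sum_product mult_ac)
  then show ?thesis by (simp only: complex_norm_square)
qed

lemma trace_rank_one: "trace (rank_one \<psi>) = cinner \<psi> \<psi>"
  by (simp add: trace_def rank_one_def cinner_def mult.commute)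

lemma density_operator_rank_one: "cinner \<psi> \<psi> = 1 \<Longrightarrow> density_operator (rank_one \<psi>)"
  by (simp add: density_operator_def positive_op_def cinner_rank_one trace_rank_one
      nonneg_Reals_of_real_iff)

lemma op_scale_rank_one:
  "op_scale (complex_of_real (c\<^sup>2)) (rank_one \<psi>) = rank_one (complex_of_real c *s \<psi>)"
  by (simp add: op_scale_def rank_one_def vec_eq_iff power2_eq_square mult_ac)

section \<open>Linear maps that fix every density operator\<close>

text \<open>A nonzero rank-one operator is a positive multiple of a pure state, so homogeneity of
  \<open>F\<close> suffices; the vector 0 gives the operator 0.\<close>

lemma linear_fixes_rank_one:
  fixes F :: "'a::finite operator \<Rightarrow> 'a operator"
  assumes lin: "Vector_Spaces.linear op_scale op_scale F"
    and fix_density: "\<And>\<rho>. density_operator \<rho> \<Longrightarrow> F \<rho> = \<rho>"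
  shows "F (rank_one \<psi>) = rank_one \<psi>"
proof -
  interpret F: Vector_Spaces.linear op_scale op_scale F by (rule lin)
  define r where "r = sqrt (\<Sum>i\<in>UNIV. (cmod (\<psi> $ i))\<^sup>2)"
  have r2: "r\<^sup>2 = (\<Sum>i\<in>UNIV. (cmod (\<psi> $ i))\<^sup>2)"
    unfolding r_def by (intro real_sqrt_pow2 sum_nonneg) simp
  show ?thesis
  proof (cases "r = 0")
    case True
    then have "\<psi> = 0" using r2 by (simp add: sum_nonneg_eq_0_iff vec_eq_iff)
    then have "rank_one \<psi> = 0" by (simp add: rank_one_def vec_eq_iff)
    then show ?thesis using F.zero by simp
  next
    case False
    define \<phi> where "\<phi> = complex_of_real (1 / r) *s \<psi>"
    have "cinner \<phi> \<phi> = complex_of_real ((\<Sum>i\<in>UNIV. (cmod (\<psi> $ i))\<^sup>2) / r\<^sup>2)"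
      by (simp add: cinner_self \<phi>_def norm_divide power_divide sum_divide_distrib)
    also have "\<dots> = 1" using False by (simp flip: r2)
    finally have "F (rank_one \<phi>) = rank_one \<phi>"
      by (intro fix_density density_operator_rank_one)
    moreover have "\<psi> = complex_of_real r *s \<phi>"
      using False by (simp add: \<phi>_def vec_eq_iff)
    then have "rank_one \<psi> = op_scale (complex_of_real (r\<^sup>2)) (rank_one \<phi>)"
      by (simp only: op_scale_rank_one)
    ultimately show ?thesis by (simp add: F.scale)
  qed
qed

text \<open>Polarization with two mixed vectors. The factor \<i> before the second one makes the
  cross terms \<open>matrix_unit b a\<close> cancel and the terms \<open>matrix_unit a b\<close> add
  up; the diagonal terms then occur with coefficient 1 + \<i>, and the last summand removes
  them.\<close>

lemma matrix_unit_polarization: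
  "matrix_unit a b = op_scale (1/2)
     (rank_one (axis a 1 + axis b 1) + op_scale \<i> (rank_one (axis a 1 + \<i> *s axis b 1)) +
      op_scale (- 1 - \<i>) (rank_one (axis a 1) + rank_one (axis b 1)))"
  by (auto simp: vec_eq_iff matrix_unit_def op_scale_def rank_one_def axis_def algebra_simps)

text \<open>Matrix units span all operators, so \<open>F\<close> is in fact the identity. This form
  can be used directly on the blocks of a Choi operator.\<close>

lemma linear_fixes_matrix_unit:
  fixes F :: "'a::finite operator \<Rightarrow> 'a operator"
  assumes lin: "Vector_Spaces.linear op_scale op_scale F"
    and fix_density: "\<And>\<rho>. density_operator \<rho> \<Longrightarrow> F \<rho> = \<rho>"
  shows "F (matrix_unit a b) = matrix_unit a b"
proof -
  interpret F: Vector_Spaces.linear op_scale op_scale F by (rule lin)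
  show ?thesis
    unfolding matrix_unit_polarization
    by (simp add: F.add F.scale linear_fixes_rank_one[OF assms])
qed

lemma linear_trace_fst:
  "Vector_Spaces.linear op_scale op_scale (trace_fst :: ('a::finite \<times> 'b::finite) operator \<Rightarrow> _)"
  by (intro Vector_Spaces.linear_iff[THEN iffD2] conjI vector_space_op_scale allI)
    (auto simp: trace_fst_def op_scale_def vec_eq_iff sum.distrib sum_distrib_left)

lemma linear_trace_snd:
  "Vector_Spaces.linear op_scale op_scale (trace_snd :: ('a::finite \<times> 'b::finite) operator \<Rightarrow> _)"
  by (intro Vector_Spaces.linear_iff[THEN iffD2] conjI vector_space_op_scale allI)
    (auto simp: trace_snd_def op_scale_def vec_eq_iff sum.distrib sum_distrib_left)

lemma universal_broadcasting_matrix_unit: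
  assumes "universal_broadcasting E"
  shows "trace_snd (E (matrix_unit a b)) = matrix_unit a b"
    and "trace_fst (E (matrix_unit a b)) = matrix_unit a b"
proof -
  have lin: "Vector_Spaces.linear op_scale op_scale E"
    and br: "\<And>\<rho>. density_operator \<rho> \<Longrightarrow> (trace_snd \<circ> E) \<rho> = \<rho> \<and> (trace_fst \<circ> E) \<rho> = \<rho>"
    using assms by (auto simp: universal_broadcasting_def tpcp_def broadcasting_def)
  show "trace_snd (E (matrix_unit a b)) = matrix_unit a b"
    using linear_fixes_matrix_unit[OF Vector_Spaces.linear_compose[OF lin linear_trace_snd]] br
    by (metis comp_apply)
  show "trace_fst (E (matrix_unit a b)) = matrix_unit a b"
    using linear_fixes_matrix_unit[OF Vector_Spaces.linear_compose[OF lin linear_trace_fst]] br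
    by (metis comp_apply)
qed

section \<open>The Choi state and its positivity\<close>

lemma cinner_matrix_unit:
  "cinner v (matrix_unit a b *v w) = cnj (v $ a) * w $ b"
proof -
  have "cinner v (matrix_unit a b *v w) =
      (\<Sum>p\<in>UNIV. \<Sum>q\<in>UNIV. if q = b then if p = a then cnj (v $ p) * w $ q else 0 else 0)"
    unfolding cinner_matrix_vector_mult matrix_unit_def
    by (intro sum.cong refl) simp
  then show ?thesis by simp
qed

text \<open>These are the blocks of the rank-one operator given by the sum over i of the basis
  vector \<open>h i\<close> tensored with the i-th ancilla basis vector, an unnormalized entangled
  state. Hence the quadratic form is a squared modulus.\<close>

lemma positive_block_matrix_units: "positive_block k (\<lambda>i j. matrix_unit (h i) (h j))"
proof -
  have "(\<Sum>i<k. \<Sum>j<k. cinner (v i) (matrix_unit (h i) (h j) *v v j)) =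
      complex_of_real ((cmod (\<Sum>i<k. v i $ h i))\<^sup>2)" for v :: "nat \<Rightarrow> complex ^ 'a"
    unfolding complex_norm_square cinner_matrix_unit
    by (simp add: sum_product mult.commute) (rule sum.swap)
  then show ?thesis by (simp only: positive_block_def nonneg_Reals_of_real_iff) simp
qed

text \<open>The first index belongs to the untouched reference system A, the second to the output of
  \<open>E\<close>. For output type \<open>'a \<times> 'a\<close> the result therefore already has
  the index type of \<tau>. The divisor d comes from the normalization of the entangled
  state.\<close>

definition choi_state :: "('a::finite operator \<Rightarrow> 'b::finite operator) \<Rightarrow> ('a \<times> 'b) operator" where
  "choi_state E = (\<chi> x y. E (matrix_unit (fst x) (fst y)) $ snd x $ snd y / of_nat CARD('a))"

text \<open>Up to the factor 1/d, the blocks of the Choi state are the images under \<open>E\<close>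
  of the positive block operator of matrix units, so complete positivity with an ancilla of
  dimension d applies.\<close>

lemma positive_op_choi_state:
  fixes E :: "'a::finite operator \<Rightarrow> 'b::finite operator"
  assumes "completely_positive E"
  shows "positive_op (choi_state E)"
  unfolding positive_op_def
proof
  fix w :: "complex ^ ('a \<times> 'b)"
  let ?k = "CARD('a)"
  \<comment> \<open>Ancilla blocks are numbered by naturals below d, so the basis of A has to be
    enumerated.\<close>
  obtain h where h: "bij_betw h {..<?k} (UNIV :: 'a set)"
    using ex_bij_betw_nat_finite[of "UNIV :: 'a set"] by (auto simp: atLeast0LessThan)
  define v where "v a = (\<chi> p. w $ (a, p))" for a
  have "positive_block ?k (\<lambda>i j. E (matrix_unit (h i) (h j)))"
    using assms positive_block_matrix_units unfolding completely_positive_def by blast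
  then have "(\<Sum>i<?k. \<Sum>j<?k. cinner (v (h i)) (E (matrix_unit (h i) (h j)) *v v (h j))) \<in> \<real>\<^sub>\<ge>\<^sub>0"
    unfolding positive_block_def by (rule spec[where x = "\<lambda>i. v (h i)"])
  also have "(\<Sum>i<?k. \<Sum>j<?k. cinner (v (h i)) (E (matrix_unit (h i) (h j)) *v v (h j))) =
      (\<Sum>i<?k. \<Sum>b\<in>UNIV. cinner (v (h i)) (E (matrix_unit (h i) b) *v v b))"
    by (intro sum.cong refl sum.reindex_bij_betw[OF h])
  also have "\<dots> = (\<Sum>a\<in>UNIV. \<Sum>b\<in>UNIV. cinner (v a) (E (matrix_unit a b) *v v b))"
    by (rule sum.reindex_bij_betw[OF h])
  also have "\<dots> = (\<Sum>a\<in>UNIV. \<Sum>p\<in>UNIV. \<Sum>b\<in>UNIV. \<Sum>q\<in>UNIV.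
      cnj (w $ (a, p)) * E (matrix_unit a b) $ p $ q * w $ (b, q))"
    unfolding cinner_matrix_vector_mult v_def
    by (simp, intro sum.cong refl sum.swap)
  also have "\<dots> = (\<Sum>x\<in>UNIV. \<Sum>y\<in>UNIV.
      cnj (w $ x) * E (matrix_unit (fst x) (fst y)) $ snd x $ snd y * w $ y)"
    by (simp add: sum_UNIV_prod)
  also have "\<dots> = of_nat ?k * cinner w (choi_state E *v w)"
    unfolding cinner_matrix_vector_mult choi_state_def
    by (simp add: sum_distrib_left)
  finally have "of_nat ?k * cinner w (choi_state E *v w) \<in> \<real>\<^sub>\<ge>\<^sub>0" .
  then have "complex_of_real (1 / real ?k) * (of_nat ?k * cinner w (choi_state E *v w)) \<in> \<real>\<^sub>\<ge>\<^sub>0"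
    by (rule nonneg_Reals_mult_I[rotated]) (simp only: nonneg_Reals_of_real_iff, simp)
  then show "cinner w (choi_state E *v w) \<in> \<real>\<^sub>\<ge>\<^sub>0" by simp
qed

lemma trace_choi_state:
  fixes E :: "'a::finite operator \<Rightarrow> 'b::finite operator"
  assumes "\<And>X. trace (E X) = trace X"
  shows "trace (choi_state E) = 1"
proof -
  have "trace (choi_state E) = (\<Sum>a\<in>UNIV. trace (E (matrix_unit a a)) / of_nat CARD('a))"
    unfolding trace_def choi_state_def
    by (simp add: sum.cartesian_product case_prod_unfold sum_divide_distrib)
  also have "\<dots> = (\<Sum>a\<in>(UNIV :: 'a set). 1 / of_nat CARD('a))"
    by (simp add: assms) (simp add: trace_def matrix_unit_def)
  finally show ?thesis by simp
qed

section \<open>The standard maximally entangled state as a marginal of the Choi state\<close>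

lemma cinner_axis_left: "cinner (axis p 1) v = v $ p"
  by (simp add: cinner_def axis_def if_distrib if_distribR cong: if_cong)

lemma orthonormal_basis_axis: "orthonormal_basis (\<lambda>i. axis i 1)"
proof -
  have "range (\<lambda>i. axis i (1::complex)) = (cart_basis :: (complex ^ 'a) set)"
    by (auto simp: cart_basis_def)
  then have "vec.span (range (\<lambda>i. axis i (1::complex))) = (UNIV :: (complex ^ 'a) set)"
    by (simp add: vec.span_Basis)
  moreover have "cinner (axis i 1) (axis j 1) = (if i = j then 1 else 0)" for i j :: 'a
    unfolding cinner_axis_left by (simp add: axis_def)
  ultimately show ?thesis by (simp add: orthonormal_basis_def)
qed

definition std_entangled :: "complex ^ ('a::finite \<times> 'a)" where
  "std_entangled = complex_of_real (1 / sqrt (real CARD('a))) *s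
     (\<Sum>j\<in>UNIV. tensor_vec (axis j 1) (axis j 1))"

lemma std_entangled_nth:
  "(std_entangled :: complex ^ ('a::finite \<times> 'a)) $ (a, b) =
     (if a = b then complex_of_real (1 / sqrt (real CARD('a))) else 0)"
proof -
  have "(\<Sum>j\<in>UNIV. tensor_vec (axis j 1) (axis j 1)) $ (a, b) =
     (\<Sum>j\<in>UNIV. if j = a then (if a = b then 1 else 0) else (0::complex))"
    unfolding sum_component
    by (intro sum.cong) (auto simp: tensor_vec_def axis_def)
  then show ?thesis by (simp add: std_entangled_def)
qed

text \<open>The right-hand side is the corresponding entry of the Choi state of the identity
  map.\<close>

lemma rank_one_std_entangled:
  "rank_one (std_entangled :: complex ^ ('a::finite \<times> 'a)) $ x $ y =
     matrix_unit (fst x) (fst y) $ snd x $ snd y / of_nat CARD('a)"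
proof -
  have "complex_of_real (sqrt (real CARD('a))) * complex_of_real (sqrt (real CARD('a)))
      = of_nat CARD('a)"
    by (metis of_nat_0_le_iff of_real_mult of_real_of_nat_eq real_sqrt_mult_self abs_of_nat)
  then show ?thesis
    by (cases x; cases y) (auto simp: rank_one_def std_entangled_nth matrix_unit_def)
qed

lemma maximally_entangled_std: "maximally_entangled (rank_one std_entangled)"
  unfolding maximally_entangled_def std_entangled_def
  using orthonormal_basis_axis by blast

lemma pure_state_std: "pure_state (rank_one (std_entangled :: complex ^ ('a::finite \<times> 'a)))"
proof -
  have "trace (rank_one (std_entangled :: complex ^ ('a \<times> 'a))) =
      (\<Sum>a\<in>(UNIV :: 'a set). \<Sum>b\<in>UNIV. (if b = a then 1 else 0) / of_nat CARD('a))"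
    by (simp add: trace_def rank_one_std_entangled matrix_unit_def sum_UNIV_prod)
  also have "\<dots> = 1" by (simp flip: sum_divide_distrib)
  finally show ?thesis by (auto simp: pure_state_def trace_rank_one)
qed

text \<open>The partial trace touches only the output of \<open>E\<close>, so it yields the Choi
  state of the reduced map \<open>trace_snd \<circ> E\<close>, which acts as the identity on matrix
  units. The next lemma is the same for the other output.\<close>

lemma trace_third_choi_state:
  assumes "\<And>a b. trace_snd (E (matrix_unit a b)) = matrix_unit a b"
  shows "trace_third (choi_state E) = rank_one std_entangled"
  using assms
  by (simp add: vec_eq_iff rank_one_std_entangled trace_third_def trace_snd_def choi_state_def
      flip: sum_divide_distrib)

lemma trace_second_choi_state:
  assumes "\<And>a b. trace_fst (E (matrix_unit a b)) = matrix_unit a b"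
  shows "trace_second (choi_state E) = rank_one std_entangled"
  using assms
  by (simp add: vec_eq_iff rank_one_std_entangled trace_second_def trace_fst_def choi_state_def
      flip: sum_divide_distrib)

section \<open>Positive operators with a pure marginal\<close>

lemma real_affine_nonneg_imp_0:
  fixes x y :: real
  assumes "\<And>s. s * x + y \<ge> 0"
  shows "x = 0"
proof (rule ccontr)
  assume "x \<noteq> 0"
  \<comment> \<open>At this s the affine function takes the value -1.\<close>
  then show False using assms[of "(- y - 1) / x"] by simp
qed

lemma complex_affine_nonneg_imp_0:
  assumes "\<And>s. complex_of_real s * x + y \<in> \<real>\<^sub>\<ge>\<^sub>0"
  shows "x = 0"
proof -
  have "Re x = 0"
    using assms by (intro real_affine_nonneg_imp_0[of _ "Re y"]) (simp add: complex_nonneg_Reals_iff)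
  \<comment> \<open>The values at 0 and 1 are both real, hence so is their difference x.\<close>
  moreover have "Im x = 0"
    using assms[of 0] assms[of 1] by (simp add: complex_nonneg_Reals_iff)
  ultimately show ?thesis by (simp add: complex_eq_iff)
qed

lemma cinner_add_left: "cinner (u + v) w = cinner u w + cinner v w"
  by (simp add: cinner_def algebra_simps sum.distrib)

lemma cinner_add_right: "cinner u (v + w) = cinner u v + cinner u w"
  by (simp add: cinner_def algebra_simps sum.distrib)

lemma cinner_scale_left: "cinner (c *s u) v = cnj c * cinner u v"
  by (simp add: cinner_def sum_distrib_left mult_ac)

lemma cinner_scale_right: "cinner u (c *s v) = c * cinner u v"
  by (simp add: cinner_def sum_distrib_left mult_ac)

text \<open>A degenerate case of Cauchy-Schwarz. Since the term quadratic in t vanishes, the form at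
  \<open>t *s w + u\<close> is real-affine in t, and it can stay nonnegative only if its linear part
  is zero.\<close>

lemma positive_op_isotropic:
  assumes pos: "positive_op X" and iso: "cinner w (X *v w) = 0"
  shows "cinner u (X *v w) = 0" and "cinner w (X *v u) = 0"
proof -
  define \<alpha> \<beta> \<gamma> where "\<alpha> = cinner w (X *v u)" and "\<beta> = cinner u (X *v w)"
    and "\<gamma> = cinner u (X *v u)"
  have "cnj t * \<alpha> + t * \<beta> + \<gamma> \<in> \<real>\<^sub>\<ge>\<^sub>0" for t
  proof -
    have "cinner (t *s w + u) (X *v (t *s w + u)) = cnj t * \<alpha> + t * \<beta> + \<gamma>"
      by (simp add: cinner_add_left cinner_add_right cinner_scale_left cinner_scale_right
          matrix_vector_right_distrib vec.scale iso \<alpha>_def \<beta>_def \<gamma>_def)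
    then show ?thesis using pos unfolding positive_op_def by metis
  qed
  note nonneg = this
  \<comment> \<open>Real t isolates the sum of the two cross terms, imaginary t their
    difference.\<close>
  have "\<alpha> + \<beta> = 0"
    using nonneg[of "complex_of_real _"]
    by (intro complex_affine_nonneg_imp_0[of _ \<gamma>]) (simp add: algebra_simps)
  moreover have "\<i> * (\<beta> - \<alpha>) = 0"
    using nonneg[of "\<i> * complex_of_real _"]
    by (intro complex_affine_nonneg_imp_0[of _ \<gamma>]) (simp add: algebra_simps)
  ultimately show "cinner u (X *v w) = 0" and "cinner w (X *v u) = 0"
    by (auto simp: \<alpha>_def \<beta>_def)
qed

text \<open>
  For \<open>v\<close> orthogonal to \<open>\<psi>\<close> the nonnegative diagonal blocks of \<open>X\<close> at \<open>v\<close> sum to zero, so \<open>X\<close>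
  annihilates \<open>v\<close> tensored with any basis vector, from both sides.
\<close>

lemma positive_op_pure_marginal:
  fixes X :: "('p::finite \<times> 'c::finite) operator"
  assumes pos: "positive_op X" and unit: "cinner \<psi> \<psi> = 1" and marg: "trace_snd X = rank_one \<psi>"
  obtains \<sigma> where "\<And>p c q c'. X $ (p, c) $ (q, c') = \<psi> $ p * cnj (\<psi> $ q) * \<sigma> c c'"
proof -
  \<comment> \<open>This is \<open>v\<close> tensored with the basis vector \<open>c\<close> of the
    second factor.\<close>
  define emb where "emb v c = (\<chi> x. if snd x = c then v $ fst x else 0)"
    for v :: "complex ^ 'p" and c :: 'c
  have cinner_emb: "cinner (emb v c) (X *v emb w c') =
      (\<Sum>p\<in>UNIV. \<Sum>q\<in>UNIV. cnj (v $ p) * X $ (p, c) $ (q, c') * w $ q)" for v w c c'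
  proof -
    have "cinner (emb v c) (X *v emb w c') =
      (\<Sum>p\<in>UNIV. \<Sum>s\<in>UNIV. \<Sum>q\<in>UNIV. \<Sum>s'\<in>UNIV.
         cnj (emb v c $ (p, s)) * X $ (p, s) $ (q, s') * emb w c' $ (q, s'))"
      by (simp add: cinner_matrix_vector_mult sum_UNIV_prod)
    also have "\<dots> = (\<Sum>p\<in>UNIV. \<Sum>s\<in>UNIV. if s = c then
         (\<Sum>q\<in>UNIV. \<Sum>s'\<in>UNIV. cnj (v $ p) * X $ (p, s) $ (q, s') * emb w c' $ (q, s')) else 0)"
      by (intro sum.cong refl) (simp add: emb_def)
    finally have "cinner (emb v c) (X *v emb w c') = (\<Sum>p\<in>UNIV. \<Sum>q\<in>UNIV. \<Sum>s'\<in>UNIV.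
        cnj (v $ p) * X $ (p, c) $ (q, s') * emb w c' $ (q, s'))"
      by (simp only: sum.delta finite UNIV_I if_True)
    moreover have "y * emb w c' $ (q, s') = (if s' = c' then y * w $ q else 0)" for y q s'
      by (simp add: emb_def)
    ultimately show ?thesis by simp
  qed
  have iso: "cinner (emb v c) (X *v emb v c) = 0" if "cinner v \<psi> = 0" for v c
  proof -
    have "(\<Sum>s\<in>UNIV. cinner (emb v s) (X *v emb v s)) =
        (\<Sum>p\<in>UNIV. \<Sum>q\<in>UNIV. \<Sum>s\<in>UNIV. cnj (v $ p) * X $ (p, s) $ (q, s) * v $ q)"
      unfolding cinner_emb by (subst sum.swap, intro sum.cong refl sum.swap)
    also have "\<dots> = cinner v (trace_snd X *v v)"
      by (simp add: cinner_matrix_vector_mult trace_snd_def sum_distrib_left sum_distrib_right)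
    also have "\<dots> = 0" using that by (simp add: marg cinner_rank_one)
    finally have sum0: "(\<Sum>s\<in>UNIV. cinner (emb v s) (X *v emb v s)) = 0" .
    have nn: "cinner (emb v s) (X *v emb v s) \<in> \<real>\<^sub>\<ge>\<^sub>0" for s
      using pos by (simp add: positive_op_def)
    have "(\<Sum>s\<in>UNIV. Re (cinner (emb v s) (X *v emb v s))) = 0"
      using sum0 by (simp flip: Re_sum)
    then have "Re (cinner (emb v c) (X *v emb v c)) = 0"
      using nn by (subst (asm) sum_nonneg_eq_0_iff) (auto simp: complex_nonneg_Reals_iff)
    then show ?thesis using nn[of c] by (simp add: complex_nonneg_Reals_iff complex_eq_iff)
  qed
  \<comment> \<open>The component of the p-th basis vector orthogonal to \<psi>; the coefficient is
    the inner product of \<psi> with that basis vector.\<close>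
  define P where "P p = axis p 1 + (- cnj (\<psi> $ p)) *s \<psi>" for p
  have orth: "cinner (P p) \<psi> = 0" for p
    unfolding P_def cinner_add_left cinner_scale_left cinner_axis_left unit by simp
  have emb_axis: "emb (axis p 1) c = emb (P p) c + cnj (\<psi> $ p) *s emb \<psi> c" for p c
    by (auto simp: emb_def P_def vec_eq_iff)
  \<comment> \<open>The compression of \<open>X\<close> to the subspace of vectors \<psi> tensored
    with the second factor.\<close>
  define \<sigma> where "\<sigma> c c' = cinner (emb \<psi> c) (X *v emb \<psi> c')" for c c'
  show thesis
  proof (rule that[of \<sigma>])
    fix p c q c'
    have "cnj (axis p 1 $ i) * y * axis q 1 $ j = (if j = q then if i = p then y else 0 else 0)"
      for i j p q :: 'p and y by (simp add: axis_def)
    then have "X $ (p, c) $ (q, c') = cinner (emb (axis p 1) c) (X *v emb (axis q 1) c')"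
      by (simp add: cinner_emb)
    \<comment> \<open>Of the four terms, the three that contain some \<open>P\<close> vanish.
      Conjugate linearity on the left turns the coefficient \<open>cnj (\<psi> $ p)\<close> into
      \<open>\<psi> $ p\<close>.\<close>
    also have "\<dots> = \<psi> $ p * cnj (\<psi> $ q) * \<sigma> c c'"
      unfolding emb_axis
      by (simp add: cinner_add_left cinner_add_right cinner_scale_left cinner_scale_right
          matrix_vector_right_distrib vec.scale positive_op_isotropic[OF pos iso[OF orth]] \<sigma>_def)
    finally show "X $ (p, c) $ (q, c') = \<psi> $ p * cnj (\<psi> $ q) * \<sigma> c c'" .
  qed
qed

section \<open>Marginals of maximally entangled states and monogamy\<close>

text \<open>Orthonormality says that the adjoint of the matrix with columns \<open>e j\<close> is
  its left inverse. For square matrices it is then a right inverse too, which is the resolution of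
  the identity.\<close>

lemma orthonormal_basis_completeness:
  fixes e :: "'a \<Rightarrow> complex ^ 'a::finite"
  assumes "orthonormal_basis e"
  shows "(\<Sum>j\<in>UNIV. e j $ a * cnj (e j $ b)) = (if a = b then 1 else 0)"
proof -
  define U where "U = (\<chi> i j. e j $ i)"
  define V where "V = (\<chi> i j. cnj (e i $ j))"
  have "V ** U = mat 1"
    using assms
    by (simp add: U_def V_def matrix_matrix_mult_def mat_def vec_eq_iff orthonormal_basis_def cinner_def)
  then have "U ** V = mat 1" by (simp add: matrix_left_right_inverse)
  then have "(U ** V) $ a $ b = mat 1 $ a $ b" by simp
  then show ?thesis by (simp add: U_def V_def matrix_matrix_mult_def mat_def)
qed

text \<open>Tracing out the second factor produces inner products of the \<open>f j\<close>, whose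
  orthonormality leaves only the diagonal j = k; completeness of \<open>e\<close> turns the
  remaining sum into the identity.\<close>

lemma maximally_entangled_marginal:
  fixes \<rho> :: "('a::finite \<times> 'a) operator"
  assumes "maximally_entangled \<rho>"
  shows "trace_snd \<rho> $ a $ b = (if a = b then 1 / of_nat CARD('a) else 0)"
proof -
  obtain e f where e: "orthonormal_basis e" and f: "orthonormal_basis f"
    and \<rho>: "\<rho> = rank_one (complex_of_real (1 / sqrt (real CARD('a))) *s
              (\<Sum>j\<in>UNIV. tensor_vec (e j) (f j)))"
    using assms by (auto simp: maximally_entangled_def)
  define c where "c = complex_of_real (1 / sqrt (real CARD('a)))"
  have c: "c * cnj c = 1 / of_nat CARD('a)"
    unfolding c_def complex_cnj_complex_of_real of_real_mult[symmetric]
    by (simp flip: real_sqrt_mult)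
  have "trace_snd \<rho> $ a $ b = (\<Sum>s\<in>UNIV. \<Sum>j\<in>UNIV. \<Sum>k\<in>UNIV.
      c * cnj c * (e j $ a * cnj (e k $ b) * (cnj (f k $ s) * f j $ s)))"
    unfolding \<rho> c_def[symmetric]
    by (simp add: trace_snd_def rank_one_def tensor_vec_def sum_product sum_distrib_left mult_ac)
      (intro sum.cong refl sum.swap)
  also have "\<dots> = (\<Sum>j\<in>UNIV. \<Sum>k\<in>UNIV. \<Sum>s\<in>UNIV.
      c * cnj c * (e j $ a * cnj (e k $ b) * (cnj (f k $ s) * f j $ s)))"
    by (subst sum.swap, intro sum.cong refl sum.swap)
  also have "\<dots> = (\<Sum>j\<in>UNIV. \<Sum>k\<in>UNIV. c * cnj c * (e j $ a * cnj (e k $ b) * cinner (f k) (f j)))"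
    by (simp add: cinner_def sum_distrib_left)
  also have "\<dots> = (\<Sum>j\<in>UNIV. c * cnj c * (e j $ a * cnj (e j $ b)))"
  proof (intro sum.cong refl)
    fix j
    have "(\<Sum>k\<in>UNIV. c * cnj c * (e j $ a * cnj (e k $ b) * cinner (f k) (f j))) =
        (\<Sum>k\<in>UNIV. if k = j then c * cnj c * (e j $ a * cnj (e k $ b)) else 0)"
      using f by (intro sum.cong refl) (simp add: orthonormal_basis_def)
    then show "(\<Sum>k\<in>UNIV. c * cnj c * (e j $ a * cnj (e k $ b) * cinner (f k) (f j))) =
        c * cnj c * (e j $ a * cnj (e j $ b))"
      by simp
  qed
  also have "\<dots> = c * cnj c * (if a = b then 1 else 0)"
    by (simp add: orthonormal_basis_completeness[OF e] flip: sum_distrib_left)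
  finally show ?thesis by (simp add: c)
qed

lemma monogamy_of_entanglement:
  fixes \<tau> :: "('a::finite \<times> 'a \<times> 'c::finite) operator"
  assumes dens: "density_operator \<tau>"
    and pure3: "pure_state (trace_third \<tau>)" and ent: "maximally_entangled (trace_third \<tau>)"
    and pure2: "pure_state (trace_second \<tau>)"
  shows "CARD('a) = 1"
proof (rule ccontr)
  assume "CARD('a) \<noteq> 1"
  moreover have "(UNIV :: 'a set) = {undefined}" if "\<forall>a a' :: 'a. a = a'"
    using that by blast
  ultimately obtain a a' :: 'a where aa': "a \<noteq> a'"
    by (metis card_1_singleton_iff One_nat_def)
  \<comment> \<open>Regroups the indices of \<tau> so that A and A' form one factor, as
    \<open>positive_op_pure_marginal\<close> expects.\<close>
  define X :: "(('a \<times> 'a) \<times> 'c) operator" where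
    "X = (\<chi> x y. \<tau> $ (fst (fst x), snd (fst x), snd x) $ (fst (fst y), snd (fst y), snd y))"
  obtain \<psi> where \<psi>: "cinner \<psi> \<psi> = 1" "trace_third \<tau> = rank_one \<psi>"
    using pure3 by (auto simp: pure_state_def)
  have "positive_op X"
    unfolding positive_op_def
  proof
    fix v :: "complex ^ (('a \<times> 'a) \<times> 'c)"
    define w where "w = (\<chi> x. v $ ((fst x, fst (snd x)), snd (snd x)))"
    have "bij_betw (\<lambda>x. ((fst x, fst (snd x)), snd (snd x))) UNIV (UNIV :: (('a \<times> 'a) \<times> 'c) set)"
      by (rule bij_betwI[where g = "\<lambda>x. (fst (fst x), snd (fst x), snd x)"]) auto
    note reassoc = sum.reindex_bij_betw[OF this, symmetric]
    have "cinner v (X *v v) = cinner w (\<tau> *v w)"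
      unfolding cinner_matrix_vector_mult reassoc by (simp add: X_def w_def)
    then show "cinner v (X *v v) \<in> \<real>\<^sub>\<ge>\<^sub>0"
      using dens by (simp add: density_operator_def positive_op_def)
  qed
  moreover have "trace_snd X = rank_one \<psi>"
    using \<psi>(2) by (simp add: X_def trace_snd_def trace_third_def vec_eq_iff)
  ultimately obtain \<sigma> where \<sigma>: "\<And>p c q c'. X $ (p, c) $ (q, c') = \<psi> $ p * cnj (\<psi> $ q) * \<sigma> c c'"
    using positive_op_pure_marginal \<psi>(1) by metis
  have \<tau>: "\<tau> $ (i, j, c) $ (i', j', c') = \<psi> $ (i, j) * cnj (\<psi> $ (i', j')) * \<sigma> c c'" for i j c i' j' c'
    using \<sigma>[of "(i, j)" c "(i', j')" c'] by (simp add: X_def)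
  \<comment> \<open>Summing the product form over the index of A' leaves the marginal of \<psi> on
    A, which is 1/d times the identity.\<close>
  have prod: "trace_second \<tau> $ (i, c) $ (i', c') =
      (if i = i' then 1 / of_nat CARD('a) else 0) * \<sigma> c c'" for i i' c c'
    using maximally_entangled_marginal[OF ent, of i i'] unfolding \<psi>(2)
    by (simp add: trace_second_def \<tau> trace_snd_def rank_one_def flip: sum_distrib_right)
  obtain \<phi> where \<phi>: "cinner \<phi> \<phi> = 1" "trace_second \<tau> = rank_one \<phi>"
    using pure2 by (auto simp: pure_state_def)
  have \<phi>_prod: "\<phi> $ (i, c) * cnj (\<phi> $ (i', c')) =
      (if i = i' then 1 / of_nat CARD('a) else 0) * \<sigma> c c'" for i i' c c'
    using prod[of i c i' c'] by (simp add: \<phi>(2) rank_one_def)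
  \<comment> \<open>The vanishing of a 2-by-2 minor of a rank-one operator gives \<open>\<sigma> c c * \<sigma> c c = 0\<close>.\<close>
  have "\<sigma> c c = 0" for c
    using \<phi>_prod[of a c a c] \<phi>_prod[of a' c a' c] \<phi>_prod[of a c a' c] aa' by auto
  \<comment> \<open>The squared modulus of an entry of \<phi> is a diagonal entry of \<sigma>
    divided by d, so \<phi> vanishes, against its unit norm.\<close>
  then have "\<phi> $ x = 0" for x
    using \<phi>_prod[of "fst x" "snd x" "fst x" "snd x"] by simp
  then show False using \<phi>(1) by (simp add: cinner_def)
qed

section \<open>Broadcasting in dimension one, and the equivalence\<close>

text \<open>All operators here are scalars and the map keeps the single entry, so it is the identity
  of the complex numbers up to a change of index type.\<close>

lemma universal_broadcasting_dim_1:
  assumes "CARD('n::finite) = 1"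
  shows "universal_broadcasting
    ((\<lambda>X. \<chi> p q. X $ fst p $ fst q) :: 'n operator \<Rightarrow> ('n \<times> 'n) operator)"
    (is "universal_broadcasting ?E")
proof -
  obtain o' :: 'n where U: "UNIV = {o'}" using assms by (auto simp: card_1_singleton_iff)
  then have o': "x = o'" for x by auto
  have UU: "UNIV = {(o', o')}" using o' by auto
  have "Vector_Spaces.linear op_scale op_scale ?E"
    by (intro Vector_Spaces.linear_iff[THEN iffD2] conjI vector_space_op_scale allI)
      (auto simp: op_scale_def vec_eq_iff)
  moreover have "completely_positive ?E"
    unfolding completely_positive_def positive_block_def
  proof (intro allI impI)
    fix k and X :: "nat \<Rightarrow> nat \<Rightarrow> 'n operator" and v :: "nat \<Rightarrow> complex ^ ('n \<times> 'n)"
    assume pos: "\<forall>v. (\<Sum>i<k. \<Sum>j<k. cinner (v i) (X i j *v v j)) \<in> \<real>\<^sub>\<ge>\<^sub>0"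
    \<comment> \<open>A vector on the pair space has only its diagonal entry, which turns it into a
      vector on the original space to which the hypothesis applies.\<close>
    have "(\<Sum>i<k. \<Sum>j<k. cinner (v i) (?E (X i j) *v v j)) =
        (\<Sum>i<k. \<Sum>j<k. cinner (\<chi> a. v i $ (a, a)) (X i j *v (\<chi> a. v j $ (a, a))))"
      by (simp add: cinner_matrix_vector_mult U UU)
    also have "\<dots> \<in> \<real>\<^sub>\<ge>\<^sub>0" by (rule pos[rule_format])
    finally show "(\<Sum>i<k. \<Sum>j<k. cinner (v i) (?E (X i j) *v v j)) \<in> \<real>\<^sub>\<ge>\<^sub>0" .
  qed
  moreover have "trace (?E X) = trace X" for X by (simp add: trace_def U UU)
  moreover have "trace_snd (?E X) = X" for X by (simp add: trace_snd_def vec_eq_iff U)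
  moreover have "trace_fst (?E X) = X" for X
  proof -
    have "trace_fst (?E X) $ i $ j = X $ i $ j" for i j
      by (simp add: trace_fst_def U o'[of i] o'[of j])
    then show ?thesis by (simp add: vec_eq_iff)
  qed
  ultimately show ?thesis
    by (simp add: universal_broadcasting_def tpcp_def broadcasting_def)
qed

theorem theoremV5:
  "(\<exists>E :: 'n::finite operator \<Rightarrow> ('n \<times> 'n) operator. universal_broadcasting E) \<longleftrightarrow>
   (\<exists>\<tau> :: ('n \<times> 'n \<times> 'n) operator. density_operator \<tau> \<and>
      pure_state (trace_third \<tau>) \<and> maximally_entangled (trace_third \<tau>) \<and>
      pure_state (trace_second \<tau>) \<and> maximally_entangled (trace_second \<tau>))"
proof
  assume "\<exists>E :: 'n operator \<Rightarrow> ('n \<times> 'n) operator. universal_broadcasting E"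
  then obtain E :: "'n operator \<Rightarrow> ('n \<times> 'n) operator" where E: "universal_broadcasting E" ..
  have "density_operator (choi_state E)"
    using E by (auto simp: universal_broadcasting_def tpcp_def density_operator_def
        intro: positive_op_choi_state trace_choi_state)
  moreover have "trace_third (choi_state E) = rank_one std_entangled"
    and "trace_second (choi_state E) = rank_one std_entangled"
    using universal_broadcasting_matrix_unit[OF E]
    by (simp_all add: trace_third_choi_state trace_second_choi_state)
  ultimately show "\<exists>\<tau> :: ('n \<times> 'n \<times> 'n) operator. density_operator \<tau> \<and>
      pure_state (trace_third \<tau>) \<and> maximally_entangled (trace_third \<tau>) \<and>
      pure_state (trace_second \<tau>) \<and> maximally_entangled (trace_second \<tau>)"
    by (intro exI[of _ "choi_state E"]) (simp add: pure_state_std maximally_entangled_std)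
next
  assume "\<exists>\<tau> :: ('n \<times> 'n \<times> 'n) operator. density_operator \<tau> \<and>
      pure_state (trace_third \<tau>) \<and> maximally_entangled (trace_third \<tau>) \<and>
      pure_state (trace_second \<tau>) \<and> maximally_entangled (trace_second \<tau>)"
  then have "CARD('n) = 1" using monogamy_of_entanglement by blast
  then show "\<exists>E :: 'n operator \<Rightarrow> ('n \<times> 'n) operator. universal_broadcasting E"
    using universal_broadcasting_dim_1 by blast
qed

end
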